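(* Let $C,C'$ be finite-dimensional complexes of complex vector spaces whose differentials are matrices with entries in $\mathbb C[k_1,\dots,k_m]$, both having homology only along $Q=0$ for an irreducible $Q\in\mathbb C[k]$. Let $Q(q)=0$ and suppose there is a homotopy equivalence $C\leftrightarrow C'$ given by four matrices with entries in $\mathbb C(k)$ that are regular at $q$. Then $q$ is a regular homology point of $C$ if and only if it is a regular homology point of $C'$.
   Context: A homotopy equivalence: chain maps $R:C\to C'$, $L:C'\to C$ and $u\in\operatorname{End}^{-1}(C)$, $u'\in\operatorname{End}^{-1}(C')$ with $LR=1-du-ud$, $RL=1-d'u'-u'd'$ (here holding over $\mathbb C(k)$). For a complex $C$ with polynomial differential $d$, $\mathfrak h_k$ is the homology at $k$. A point $q$ is a regular homology point if $Q(q)=0$ and $q$ is a smooth point of $Q=0$; $\dim\mathfrak h_k=\dim\mathfrak h_q$ for all $k$ with $Q(k)=0$ in a Zariski neighborhood of $q$; and there is $\xi\in T_q\mathbb C^m$ with $\dot Q\ne0$ such that the differential induced on $\mathfrak h_q$ by $\dot d$ (derivative along $\xi$ at $q$) is exact. *)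

theory Defs
  imports "HOL-Analysis.Analysis"
begin

section \<open>Polynomial functions on C^m (C[k_1,...,k_m])\<close>

text \<open>Since C is infinite, C[k_1..k_m] is identified with the ring of polynomial
functions on C^m; the index type 'm (finite) has m = CARD('m) elements.\<close>

inductive mpoly_fun :: "(complex^'m \<Rightarrow> complex) \<Rightarrow> bool" where
  const: "mpoly_fun (\<lambda>k. c)"
| coord: "mpoly_fun (\<lambda>k. k $ i)"
| add: "mpoly_fun f \<Longrightarrow> mpoly_fun g \<Longrightarrow> mpoly_fun (\<lambda>k. f k + g k)"
| mult: "mpoly_fun f \<Longrightarrow> mpoly_fun g \<Longrightarrow> mpoly_fun (\<lambda>k. f k * g k)"

definition is_const_fun :: "(complex^'m \<Rightarrow> complex) \<Rightarrow> bool" where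
  "is_const_fun f \<longleftrightarrow> (\<exists>c. \<forall>k. f k = c)"

text \<open>Irreducible element of C[k]: a non-unit nonzero (i.e. nonconstant)
polynomial whose factorisations always have a unit (nonzero constant) factor.\<close>
definition irreducible_mpoly :: "(complex^'m \<Rightarrow> complex) \<Rightarrow> bool" where
  "irreducible_mpoly Q \<longleftrightarrow> mpoly_fun Q \<and> \<not> is_const_fun Q \<and>
     (\<forall>A B. mpoly_fun A \<and> mpoly_fun B \<and> (\<forall>k. Q k = A k * B k)
        \<longrightarrow> is_const_fun A \<or> is_const_fun B)"

text \<open>Matrix with polynomial entries.\<close>
definition poly_mat :: "(complex^'m \<Rightarrow> complex^'a^'b) \<Rightarrow> bool" where
  "poly_mat M \<longleftrightarrow> (\<forall>i j. mpoly_fun (\<lambda>k. M k $ i $ j))"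

section \<open>Rational functions regular at q, identities over C(k)\<close>

definition rat_regular_at :: "complex^'m \<Rightarrow> (complex^'m \<Rightarrow> complex) \<Rightarrow> bool" where
  "rat_regular_at q f \<longleftrightarrow> (\<exists>p g. mpoly_fun p \<and> mpoly_fun g \<and> g q \<noteq> 0 \<and>
       (\<forall>k. f k = p k / g k))"

definition rat_mat_regular_at :: "complex^'m \<Rightarrow> (complex^'m \<Rightarrow> complex^'a^'b) \<Rightarrow> bool" where
  "rat_mat_regular_at q M \<longleftrightarrow> (\<forall>i j. rat_regular_at q (\<lambda>k. M k $ i $ j))"

text \<open>Two rational (matrix-valued) functions are equal in C(k) iff they agree on
a nonempty Zariski open set, i.e. off the zero set of a nonzero polynomial.\<close>
definition eq_over_Ck :: "(complex^'m \<Rightarrow> 'x) \<Rightarrow> (complex^'m \<Rightarrow> 'x) \<Rightarrow> bool" where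
  "eq_over_Ck F G \<longleftrightarrow> (\<exists>g. mpoly_fun g \<and> (\<exists>k. g k \<noteq> 0) \<and> (\<forall>k. g k \<noteq> 0 \<longrightarrow> F k = G k))"

section \<open>Graded spaces and degrees of maps\<close>

text \<open>A finite-dimensional graded complex vector space is C^'n with a grading of the
standard basis, deg :: 'n => int. A map C^'a -> C^'b has degree r if it maps
degree-j basis vectors into degree j+r.\<close>
definition has_degree :: "('a \<Rightarrow> int) \<Rightarrow> ('b \<Rightarrow> int) \<Rightarrow> int \<Rightarrow> (complex^'m \<Rightarrow> complex^'a^'b) \<Rightarrow> bool" where
  "has_degree dA dB r M \<longleftrightarrow> (\<forall>k i j. dB i \<noteq> dA j + r \<longrightarrow> M k $ i $ j = 0)"

section \<open>Homology at a point\<close>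

definition hdim :: "complex^'n^'n \<Rightarrow> nat" where
  "hdim A = vec.dim {x. A *v x = 0} - vec.dim (range (\<lambda>x. A *v x))"

definition poly_complex :: "('n \<Rightarrow> int) \<Rightarrow> (complex^'m \<Rightarrow> complex^'n^'n) \<Rightarrow> bool" where
  "poly_complex deg d \<longleftrightarrow> poly_mat d \<and> has_degree deg deg 1 d \<and> (\<forall>k. d k ** d k = 0)"

definition homology_only_along :: "(complex^'m \<Rightarrow> complex) \<Rightarrow> (complex^'m \<Rightarrow> complex^'n^'n) \<Rightarrow> bool" where
  "homology_only_along Q d \<longleftrightarrow> (\<forall>k. Q k \<noteq> 0 \<longrightarrow> hdim (d k) = 0)"

section \<open>Regular homology points\<close>

definition dirderiv :: "(complex^'m \<Rightarrow> complex) \<Rightarrow> complex^'m \<Rightarrow> complex^'m \<Rightarrow> complex" where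
  "dirderiv f q \<xi> = deriv (\<lambda>t. f (q + t *s \<xi>)) 0"

definition dmat_dot :: "(complex^'m \<Rightarrow> complex^'n^'n) \<Rightarrow> complex^'m \<Rightarrow> complex^'m \<Rightarrow> complex^'n^'n" where
  "dmat_dot d q \<xi> = (\<chi> i j. dirderiv (\<lambda>k. d k $ i $ j) q \<xi>)"

text \<open>Exactness of the differential induced by B on H = ker A / im A, expressed on
representatives: (preimage in ker A of) the kernel of the induced map equals
(preimage of) its image.\<close>
definition induced_exact :: "complex^'n^'n \<Rightarrow> complex^'n^'n \<Rightarrow> bool" where
  "induced_exact A B \<longleftrightarrow>
     {x. A *v x = 0 \<and> B *v x \<in> range (\<lambda>z. A *v z)} =
     {B *v y + A *v z | y z. A *v y = 0}"

text \<open>Smooth point of the hypersurface Q = 0 (Q irreducible, hence reduced):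
Q(q) = 0 and the gradient of Q at q is nonzero.\<close>
definition smooth_point :: "(complex^'m \<Rightarrow> complex) \<Rightarrow> complex^'m \<Rightarrow> bool" where
  "smooth_point Q q \<longleftrightarrow> Q q = 0 \<and> (\<exists>i. dirderiv Q q (axis i 1) \<noteq> 0)"

definition regular_homology_point ::
  "(complex^'m \<Rightarrow> complex) \<Rightarrow> (complex^'m \<Rightarrow> complex^'n^'n) \<Rightarrow> complex^'m \<Rightarrow> bool" where
  "regular_homology_point Q d q \<longleftrightarrow>
     Q q = 0 \<and> smooth_point Q q \<and>
     (\<exists>g. mpoly_fun g \<and> g q \<noteq> 0 \<and>
        (\<forall>k. Q k = 0 \<and> g k \<noteq> 0 \<longrightarrow> hdim (d k) = hdim (d q))) \<and>
     (\<exists>\<xi>. dirderiv Q q \<xi> \<noteq> 0 \<and> induced_exact (d q) (dmat_dot d q \<xi>))"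

section \<open>Homotopy equivalences with rational entries\<close>

definition homotopy_equiv_Ck ::
  "('n \<Rightarrow> int) \<Rightarrow> ('p \<Rightarrow> int) \<Rightarrow> (complex^'m \<Rightarrow> complex^'n^'n) \<Rightarrow> (complex^'m \<Rightarrow> complex^'p^'p)
   \<Rightarrow> (complex^'m \<Rightarrow> complex^'n^'p) \<Rightarrow> (complex^'m \<Rightarrow> complex^'p^'n)
   \<Rightarrow> (complex^'m \<Rightarrow> complex^'n^'n) \<Rightarrow> (complex^'m \<Rightarrow> complex^'p^'p) \<Rightarrow> bool" where
  "homotopy_equiv_Ck degC degC' d d' R L u u' \<longleftrightarrow>
     has_degree degC degC' 0 R \<and> has_degree degC' degC 0 L \<and>
     has_degree degC degC (-1) u \<and> has_degree degC' degC' (-1) u' \<and>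
     eq_over_Ck (\<lambda>k. R k ** d k) (\<lambda>k. d' k ** R k) \<and>
     eq_over_Ck (\<lambda>k. L k ** d' k) (\<lambda>k. d k ** L k) \<and>
     eq_over_Ck (\<lambda>k. L k ** R k) (\<lambda>k. mat 1 - d k ** u k - u k ** d k) \<and>
     eq_over_Ck (\<lambda>k. R k ** L k) (\<lambda>k. mat 1 - d' k ** u' k - u' k ** d' k)"

end

(* Clearing the denominators of R, L, u and u' gives a polynomial D with D q nonzero such that
   the identities of the homotopy equivalence, which hold in C(k), hold at every point where D
   does not vanish: both sides are continuous there and agree off a hypersurface, a set that
   is dense. At such points the pointwise homotopy equivalence forces hdim (d k) = hdim (d' k),
   so the Zariski-neighbourhood condition passes from d to d' after multiplying its polynomial
   by D. Differentiating the identities along the line q + t xi shows that R q and L q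
   intertwine the first-order parts dmat_dot d q xi and dmat_dot d' q xi, the derivatives of R
   and L supplying the homotopy corrections; hence R q and L q induce inverse isomorphisms of
   the homologies at q that commute with the induced differentials, and exactness of one
   induced differential gives exactness of the other. The conditions on Q are the same for
   both complexes. *)

theory Submission
  imports Defs "HOL-Computational_Algebra.Polynomial"
begin

section \<open>Homology dimension under homotopy equivalence\<close>

context finite_dimensional_vector_space
begin

lemma exists_complement_subspace:
  assumes "subspace I" "subspace K" "I \<subseteq> K"
  obtains W where "subspace W" "W \<subseteq> K" "W \<inter> I \<subseteq> {0}" "dim K \<le> dim W + dim I"
proof -
  obtain B where B: "B \<subseteq> I" "independent B" "I \<subseteq> span B" "card B = dim I"
    using basis_exists by blast
  obtain C where C: "B \<subseteq> C" "C \<subseteq> K" "independent C" "K \<subseteq> span C"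
    using maximal_independent_subset_extend[of B K] B assms(3) by blast
  define W where "W = span (C - B)"
  have "finite C"
    using C(3) finiteI_independent by blast
  have W: "subspace W" "W \<subseteq> K"
    using C(2) assms(2) span_minimal[of "C - B" K] by (auto simp: W_def)
  have dim_W: "dim W = card (C - B)"
    unfolding W_def using independent_mono[OF C(3), of "C - B"] by (simp add: dim_eq_card_independent)
  let ?WI = "{x + y |x y. x \<in> W \<and> y \<in> I}"
  have "C \<subseteq> ?WI"
  proof
    fix c assume "c \<in> C"
    show "c \<in> ?WI"
    proof (cases "c \<in> B")
      case True
      then have "c \<in> I"
        using B(1) by blast
      then show ?thesis
        using subspace_0[OF W(1)] by force
    next
      case False
      then have "c \<in> W"
        unfolding W_def using \<open>c \<in> C\<close> span_base by blast
      then show ?thesis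
        using subspace_0[OF assms(1)] by force
    qed
  qed
  then have "card C \<le> dim ?WI"
    using C(3) independent_card_le_dim by blast
  moreover have "dim ?WI + dim (W \<inter> I) = dim W + dim I"
    using dim_sums_Int[OF W(1) assms(1)] .
  moreover have "card C = dim K"
    using basis_card_eq_dim[OF C(2,4,3)] .
  moreover have "card (C - B) + card B = card C"
    using \<open>finite C\<close> C(1) card_Diff_subset[of B C] card_mono[of C B] finite_subset[of B C] by simp
  ultimately have "dim (W \<inter> I) = 0" "dim K \<le> dim W + dim I"
    using dim_W B(4) by linarith+
  with W show thesis
    using that by simp
qed

end

context finite_dimensional_vector_space_pair
begin

lemma dim_quotient_le_injective:
  assumes f: "Vector_Spaces.linear s1 s2 f"
    and IK: "vs1.subspace I" "vs1.subspace K" "I \<subseteq> K"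
    and I'K': "vs2.subspace I'" "vs2.subspace K'" "I' \<subseteq> K'"
    and fK: "f ` K \<subseteq> K'" and preimage: "\<And>x. x \<in> K \<Longrightarrow> f x \<in> I' \<Longrightarrow> x \<in> I"
  shows "vs1.dim K - vs1.dim I \<le> vs2.dim K' - vs2.dim I'"
proof -
  obtain W where W: "vs1.subspace W" "W \<subseteq> K" "W \<inter> I \<subseteq> {0}" "vs1.dim K \<le> vs1.dim W + vs1.dim I"
    using vs1.exists_complement_subspace[OF IK] .
  have fW_I': "x = 0" if "x \<in> W" "f x \<in> I'" for x
    using preimage[of x] that W(2,3) by blast
  have span_W: "vs1.span W = W"
    using W(1) by (simp add: vs1.span_eq_iff)
  have "\<forall>x\<in>W. f x = 0 \<longrightarrow> x = 0"
    using fW_I' vs2.subspace_0[OF I'K'(1)] by auto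
  then have "inj_on f (vs1.span W)"
    unfolding span_W linear_inj_on_iff_eq_0[OF f W(1)] .
  then have dim_fW: "vs2.dim (f ` W) = vs1.dim W"
    using dim_image_eq[OF f] by blast
  have "f ` W \<inter> I' \<subseteq> {0}"
    using fW_I' linear_0[OF f] by blast
  then have "vs2.dim (f ` W \<inter> I') = 0"
    by simp
  then have dim_sum: "vs2.dim {x + y |x y. x \<in> f ` W \<and> y \<in> I'} = vs1.dim W + vs2.dim I'"
    using vs2.dim_sums_Int[OF linear_subspace_image[OF f W(1)] I'K'(1)] dim_fW by linarith
  have sum_K': "{x + y |x y. x \<in> f ` W \<and> y \<in> I'} \<subseteq> K'"
  proof
    fix z assume "z \<in> {x + y |x y. x \<in> f ` W \<and> y \<in> I'}"
    then obtain x y where "z = x + y" "x \<in> f ` W" "y \<in> I'"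
      by blast
    moreover from this have "x \<in> K'" "y \<in> K'"
      using fK W(2) I'K'(3) by blast+
    ultimately show "z \<in> K'"
      using vs2.subspace_add[OF I'K'(2)] by blast
  qed
  show ?thesis
    using vs2.dim_subset[OF sum_K'] dim_sum W(4) by linarith
qed

end

definition mat_homotopy_equiv ::
  "'a::field^'n^'n \<Rightarrow> 'a^'p^'p \<Rightarrow> 'a^'n^'p \<Rightarrow> 'a^'p^'n \<Rightarrow> 'a^'n^'n \<Rightarrow> 'a^'p^'p \<Rightarrow> bool" where
  "mat_homotopy_equiv A A' R L U U' \<longleftrightarrow>
     R ** A = A' ** R \<and> L ** A' = A ** L \<and>
     L ** R = mat 1 - A ** U - U ** A \<and> R ** L = mat 1 - A' ** U' - U' ** A'"

lemma matrix_mult_eq_apply: "X ** Y = Z ** W \<Longrightarrow> X *v (Y *v x) = Z *v (W *v x)"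
  by (simp add: matrix_vector_mul_assoc)

lemma matrix_mult_add_eq_apply:
  "X1 ** Y1 + X2 ** Y2 = X3 ** Y3 + X4 ** Y4 \<Longrightarrow>
    X1 *v (Y1 *v x) + X2 *v (Y2 *v x) = X3 *v (Y3 *v x) + X4 *v (Y4 *v x)"
  by (simp add: matrix_vector_mul_assoc flip: matrix_vector_mult_add_rdistrib)

lemma matrix_anticomm_apply:
  fixes A B :: "'a::ring_1^'n^'n"
  shows "A ** B + B ** A = 0 \<Longrightarrow> A *v (B *v x) = - (B *v (A *v x))"
proof -
  assume "A ** B + B ** A = 0"
  then have "(A ** B + B ** A) *v x = 0"
    by simp
  then show ?thesis
    by (simp add: matrix_vector_mul_assoc matrix_vector_mult_add_rdistrib eq_neg_iff_add_eq_0)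
qed

lemma matrix_homotopy_apply:
  fixes A U :: "'a::ring_1^'n^'n"
  shows "L ** R = mat 1 - A ** U - U ** A \<Longrightarrow> L *v (R *v x) = x - A *v (U *v x) - U *v (A *v x)"
  by (simp add: matrix_vector_mul_assoc matrix_vector_mult_diff_rdistrib)

lemma hdim_le_of_homotopy_left_inverse:
  fixes A :: "complex^'n^'n" and A' :: "complex^'p^'p"
  assumes AA: "A ** A = 0" and AA': "A' ** A' = 0" and RA: "R ** A = A' ** R" and LA: "L ** A' = A ** L"
    and LR: "L ** R = mat 1 - A ** U - U ** A"
  shows "hdim A \<le> hdim A'"
proof -
  have homology_preimage: "x \<in> range ((*v) A)"
    if x_cycle: "A *v x = 0" and Rx_boundary: "R *v x \<in> range ((*v) A')" for x
  proof -
    obtain w where w: "R *v x = A' *v w"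
      using Rx_boundary by auto
    have "x = L *v (R *v x) + A *v (U *v x)"
      using matrix_homotopy_apply[OF LR, of x] x_cycle by simp
    also have "\<dots> = A *v (L *v w + U *v x)"
      using matrix_mult_eq_apply[OF LA, of w] w by (simp add: matrix_vector_right_distrib)
    finally show ?thesis
      by blast
  qed
  have "R *v x \<in> {y. A' *v y = 0}" if "A *v x = 0" for x
    using matrix_mult_eq_apply[OF RA, of x] that by simp
  then show ?thesis
    unfolding hdim_def
    by (intro vec.dim_quotient_le_injective homology_preimage)
      (auto simp: vec.linear_subspace_kernel vec.linear_subspace_image
        matrix_vector_mul_assoc AA AA')
qed

lemma hdim_eq_if_mat_homotopy_equiv:
  fixes A :: "complex^'n^'n" and A' :: "complex^'p^'p"
  assumes "A ** A = 0" "A' ** A' = 0" "mat_homotopy_equiv A A' R L U U'"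
  shows "hdim A = hdim A'"
  using assms hdim_le_of_homotopy_left_inverse[of A A' R L U]
    hdim_le_of_homotopy_left_inverse[of A' A L R U']
  unfolding mat_homotopy_equiv_def by fastforce

section \<open>Exactness of induced differentials under homotopy equivalence\<close>

lemma induced_exact_iff:
  fixes A B :: "complex^'n^'n"
  assumes AA: "A ** A = 0" and AB: "A ** B + B ** A = 0"
  shows "induced_exact A B \<longleftrightarrow>
    (\<forall>y. A *v y = 0 \<longrightarrow> B *v (B *v y) \<in> range ((*v) A)) \<and>
    {x. A *v x = 0 \<and> B *v x \<in> range ((*v) A)} \<subseteq> {B *v y + A *v z | y z. A *v y = 0}"
    (is "_ \<longleftrightarrow> ?square \<and> ?ker_sub_im")
proof
  assume exact: "induced_exact A B"
  have "B *v (B *v y) \<in> range ((*v) A)" if "A *v y = 0" for y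
  proof -
    have "B *v y = B *v y + A *v 0"
      by simp
    then have "B *v y \<in> {B *v y + A *v z | y z. A *v y = 0}"
      using that by blast
    then show ?thesis
      using exact unfolding induced_exact_def by blast
  qed
  with exact show "?square \<and> ?ker_sub_im"
    unfolding induced_exact_def by blast
next
  assume "?square \<and> ?ker_sub_im"
  then have square: ?square and ker_sub_im: ?ker_sub_im
    by blast+
  have "A *v (B *v y + A *v z) = 0 \<and> B *v (B *v y + A *v z) \<in> range ((*v) A)"
    if y_cycle: "A *v y = 0" for y z
  proof
    show "A *v (B *v y + A *v z) = 0"
      using y_cycle matrix_anticomm_apply[OF AB, of y]
      by (simp add: matrix_vector_right_distrib matrix_vector_mul_assoc AA)
    obtain w where "B *v (B *v y) = A *v w"
      using square y_cycle by blast
    then have "B *v (B *v y + A *v z) = A *v (w - B *v z)"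
      using matrix_anticomm_apply[OF AB, of z]
      by (simp add: matrix_vector_right_distrib matrix_vector_mult_diff_distrib)
    then show "B *v (B *v y + A *v z) \<in> range ((*v) A)"
      by blast
  qed
  with ker_sub_im show "induced_exact A B"
    unfolding induced_exact_def by blast
qed

lemma induced_square_transfer:
  fixes A B :: "complex^'n^'n" and A' B' U' :: "complex^'p^'p"
    and R DR :: "complex^'n^'p" and L :: "complex^'p^'n"
  assumes AB: "A ** B + B ** A = 0" and A'B': "A' ** B' + B' ** A' = 0"
    and RA: "R ** A = A' ** R" and LA: "L ** A' = A ** L"
    and RL: "R ** L = mat 1 - A' ** U' - U' ** A'"
    and DR: "DR ** A + R ** B = B' ** R + A' ** DR"
    and square: "\<And>y. A *v y = 0 \<Longrightarrow> B *v (B *v y) \<in> range ((*v) A)"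
    and y'_cycle: "A' *v y' = 0"
  shows "B' *v (B' *v y') \<in> range ((*v) A')"
proof -
  define y where "y = L *v y'"
  have y_cycle: "A *v y = 0"
    using matrix_mult_eq_apply[OF LA, of y'] y'_cycle by (simp add: y_def)
  obtain v where v: "B *v (B *v y) = A *v v"
    using square[OF y_cycle] by blast
  have R_B: "R *v (B *v x) = B' *v (R *v x) + A' *v (DR *v x) - DR *v (A *v x)" for x
    using matrix_mult_add_eq_apply[OF DR, of x] by (simp add: algebra_simps)
  have B'A': "B' *v (A' *v w) = - (A' *v (B' *v w))" for w
    using matrix_anticomm_apply[OF A'B', of w] by simp
  define S where "S = B' *v (U' *v y') + DR *v y"
  have "R *v y = y' - A' *v (U' *v y')"
    using matrix_homotopy_apply[OF RL, of y'] y'_cycle by (simp add: y_def)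
  then have RBy: "R *v (B *v y) = B' *v y' + A' *v S"
    using R_B[of y] y_cycle
    by (simp add: S_def B'A' matrix_vector_right_distrib matrix_vector_mult_diff_distrib)
  have "A' *v (R *v v) = R *v (B *v (B *v y))"
    using matrix_mult_eq_apply[OF RA, of v] v by simp
  also have "\<dots> = B' *v (R *v (B *v y)) + A' *v (DR *v (B *v y))"
    using R_B[of "B *v y"] matrix_anticomm_apply[OF AB, of y] y_cycle by simp
  also have "\<dots> = B' *v (B' *v y') - A' *v (B' *v S) + A' *v (DR *v (B *v y))"
    by (simp add: RBy B'A' matrix_vector_right_distrib)
  finally have "B' *v (B' *v y') = A' *v (R *v v + B' *v S - DR *v (B *v y))"
    by (simp add: matrix_vector_right_distrib matrix_vector_mult_diff_distrib)
  then show ?thesis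
    by blast
qed

lemma induced_kernel_subset_image_transfer:
  fixes A B :: "complex^'n^'n" and A' B' U' :: "complex^'p^'p"
    and R DR :: "complex^'n^'p" and L DL :: "complex^'p^'n"
  assumes RA: "R ** A = A' ** R" and LA: "L ** A' = A ** L"
    and RL: "R ** L = mat 1 - A' ** U' - U' ** A'"
    and DR: "DR ** A + R ** B = B' ** R + A' ** DR"
    and DL: "DL ** A' + L ** B' = B ** L + A ** DL"
    and ker_sub_im:
      "{x. A *v x = 0 \<and> B *v x \<in> range ((*v) A)} \<subseteq> {B *v y + A *v z | y z. A *v y = 0}"
  shows "{x'. A' *v x' = 0 \<and> B' *v x' \<in> range ((*v) A')} \<subseteq> {B' *v y + A' *v z | y z. A' *v y = 0}"
proof
  fix x' assume "x' \<in> {x'. A' *v x' = 0 \<and> B' *v x' \<in> range ((*v) A')}"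
  then obtain z' where x'_cycle: "A' *v x' = 0" and z': "B' *v x' = A' *v z'"
    by blast
  define x where "x = L *v x'"
  have x_cycle: "A *v x = 0"
    using matrix_mult_eq_apply[OF LA, of x'] x'_cycle by (simp add: x_def)
  have "B *v x = A *v (L *v z' - DL *v x')"
    using matrix_mult_add_eq_apply[OF DL, of x'] matrix_mult_eq_apply[OF LA, of z'] x'_cycle z'
    by (simp add: x_def matrix_vector_mult_diff_distrib algebra_simps)
  then obtain y z where y_cycle: "A *v y = 0" and x: "x = B *v y + A *v z"
    using ker_sub_im x_cycle by blast
  have "x' = R *v x + A' *v (U' *v x')"
    using matrix_homotopy_apply[OF RL, of x'] x'_cycle by (simp add: x_def)
  also have "\<dots> = B' *v (R *v y) + A' *v (DR *v y + R *v z + U' *v x')"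
    using matrix_mult_add_eq_apply[OF DR, of y] matrix_mult_eq_apply[OF RA, of z] y_cycle
    by (simp add: x matrix_vector_right_distrib algebra_simps)
  finally have "x' = B' *v (R *v y) + A' *v (DR *v y + R *v z + U' *v x')" .
  moreover have "A' *v (R *v y) = 0"
    using matrix_mult_eq_apply[OF RA, of y] y_cycle by simp
  ultimately show "x' \<in> {B' *v y + A' *v z | y z. A' *v y = 0}"
    by blast
qed

(* DR and DL stand for the derivatives of R and L: the hypotheses DR and DL are the
   derivatives of the chain map identities R A = A' R and L A' = A L. *)
lemma induced_exact_transfer:
  fixes A B :: "complex^'n^'n" and A' B' U' :: "complex^'p^'p"
    and R DR :: "complex^'n^'p" and L DL :: "complex^'p^'n"
  assumes AA: "A ** A = 0" and A'A': "A' ** A' = 0"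
    and AB: "A ** B + B ** A = 0" and A'B': "A' ** B' + B' ** A' = 0"
    and equiv: "mat_homotopy_equiv A A' R L U U'"
    and DR: "DR ** A + R ** B = B' ** R + A' ** DR"
    and DL: "DL ** A' + L ** B' = B ** L + A ** DL"
    and exact: "induced_exact A B"
  shows "induced_exact A' B'"
proof -
  have RA: "R ** A = A' ** R" and LA: "L ** A' = A ** L"
    and RL: "R ** L = mat 1 - A' ** U' - U' ** A'"
    using equiv unfolding mat_homotopy_equiv_def by blast+
  from exact have square: "\<And>y. A *v y = 0 \<Longrightarrow> B *v (B *v y) \<in> range ((*v) A)"
    and ker_sub_im: "{x. A *v x = 0 \<and> B *v x \<in> range ((*v) A)} \<subseteq> {B *v y + A *v z | y z. A *v y = 0}"
    unfolding induced_exact_iff[OF AA AB] by blast+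
  show ?thesis
    unfolding induced_exact_iff[OF A'A' A'B']
    using induced_square_transfer[OF AB A'B' RA LA RL DR square]
      induced_kernel_subset_image_transfer[OF RA LA RL DR DL ker_sub_im]
    by blast
qed

section \<open>Polynomial and rational functions\<close>

lemma isCont_mpoly_fun: "mpoly_fun f \<Longrightarrow> isCont f k"
  by (induction rule: mpoly_fun.induct) (auto intro!: continuous_intros)

lemma mpoly_fun_prod:
  "finite S \<Longrightarrow> (\<And>x. x \<in> S \<Longrightarrow> mpoly_fun (f x)) \<Longrightarrow> mpoly_fun (\<lambda>k. \<Prod>x\<in>S. f x k)"
  by (induction S rule: finite_induct) (auto intro: mpoly_fun.intros)

lemma mpoly_fun_on_line: "mpoly_fun f \<Longrightarrow> \<exists>P. \<forall>t. f (a + t *s v) = poly P t"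
proof (induction rule: mpoly_fun.induct)
  case (const c)
  show ?case
    by (intro exI[of _ "[:c:]"]) simp
next
  case (coord i)
  show ?case
    by (intro exI[of _ "[:a $ i, v $ i:]"]) simp
next
  case (add f g)
  then obtain P1 P2 where "\<forall>t. f (a + t *s v) = poly P1 t" "\<forall>t. g (a + t *s v) = poly P2 t"
    by blast
  then show ?case
    by (intro exI[of _ "P1 + P2"]) simp
next
  case (mult f g)
  then obtain P1 P2 where "\<forall>t. f (a + t *s v) = poly P1 t" "\<forall>t. g (a + t *s v) = poly P2 t"
    by blast
  then show ?case
    by (intro exI[of _ "P1 * P2"]) simp
qed

lemma isCont_line:
  fixes a v :: "'a::real_normed_field^'n"
  shows "isCont (\<lambda>t. a + t *s v) x"
  unfolding vector_scalar_mult_def isCont_def by (intro tendsto_intros)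

lemma eventually_mpoly_fun_nonzero_on_line:
  assumes "mpoly_fun g" "g (a + v) \<noteq> 0"
  shows "\<forall>\<^sub>F t in at 0. g (a + t *s v) \<noteq> 0"
proof -
  obtain P where P: "\<And>t. g (a + t *s v) = poly P t"
    using mpoly_fun_on_line[OF assms(1)] by blast
  have "poly P 1 \<noteq> 0"
    using P[of 1] assms(2) by simp
  then have "finite {t. poly P t = 0}"
    by (intro poly_roots_finite) auto
  then have "\<forall>\<^sub>F t in at 0. t \<notin> {t. poly P t = 0}"
    using islimpt_finite islimpt_iff_eventually by blast
  then show ?thesis
    by (simp add: P)
qed

lemma eq_over_Ck_imp_eq:
  fixes F G :: "complex^'m \<Rightarrow> 'x::t2_space"
  assumes "eq_over_Ck F G" "isCont F k" "isCont G k"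
  shows "F k = G k"
proof -
  obtain g k1 where g: "mpoly_fun g" "g k1 \<noteq> 0" "\<And>k. g k \<noteq> 0 \<Longrightarrow> F k = G k"
    using assms(1) unfolding eq_over_Ck_def by blast
  define line where "line = (\<lambda>t. k + t *s (k1 - k))"
  have "\<forall>\<^sub>F t in at 0. g (line t) \<noteq> 0"
    using eventually_mpoly_fun_nonzero_on_line[OF g(1), of k "k1 - k"] g(2) by (simp add: line_def)
  then have eventually_eq: "\<forall>\<^sub>F t in at 0. F (line t) = G (line t)"
    using g(3) by (auto elim!: eventually_mono)
  have "(line \<longlongrightarrow> k) (at 0)"
    using isCont_line[where a=k and v="k1 - k" and x=0] by (simp add: line_def isCont_def)
  then have "((\<lambda>t. F (line t)) \<longlongrightarrow> F k) (at 0)" "((\<lambda>t. G (line t)) \<longlongrightarrow> G k) (at 0)"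
    using assms(2,3) isCont_tendsto_compose by blast+
  then show ?thesis
    using tendsto_cong[OF eventually_eq] tendsto_unique[OF at_neq_bot] by blast
qed

lemma eventually_nhds_mpoly_fun_nonzero:
  assumes "mpoly_fun D" "D q \<noteq> 0"
  shows "\<forall>\<^sub>F k in nhds q. D k \<noteq> 0"
proof -
  have "(D \<longlongrightarrow> D q) (nhds q)"
    using isCont_mpoly_fun[OF assms(1), of q] by (simp add: isCont_def tendsto_at_iff_tendsto_nhds)
  then show ?thesis
    using assms(2) by (rule tendsto_imp_eventually_ne)
qed

lemma isCont_matrixI:
  fixes M :: "'x::t2_space \<Rightarrow> 'a::real_normed_vector^'n^'m"
  shows "(\<And>i j. isCont (\<lambda>x. M x $ i $ j) k) \<Longrightarrow> isCont M k"
  unfolding isCont_def by (intro vec_tendstoI) simp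

lemma isCont_matrix_mult [continuous_intros]:
  fixes M :: "'x::t2_space \<Rightarrow> 'a::real_normed_algebra_1^'n^'m"
  shows "isCont M k \<Longrightarrow> isCont N k \<Longrightarrow> isCont (\<lambda>x. M x ** N x) k"
  by (rule isCont_matrixI) (auto simp: matrix_matrix_mult_def intro!: continuous_intros)

lemma isCont_poly_mat: "poly_mat M \<Longrightarrow> isCont M k"
  unfolding poly_mat_def by (auto intro!: isCont_matrixI isCont_mpoly_fun)

lemma rat_regular_at_mpoly_fun: "mpoly_fun f \<Longrightarrow> rat_regular_at q f"
  unfolding rat_regular_at_def by (intro exI[of _ f] exI[of _ "\<lambda>k. 1"]) (simp add: mpoly_fun.const)

lemma rat_mat_regular_at_poly_mat: "poly_mat M \<Longrightarrow> rat_mat_regular_at q M"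
  unfolding poly_mat_def rat_mat_regular_at_def by (simp add: rat_regular_at_mpoly_fun)

lemma rat_mat_regular_at_continuous:
  assumes "rat_mat_regular_at q M"
  obtains G where "mpoly_fun G" "G q \<noteq> 0" "\<And>k. G k \<noteq> 0 \<Longrightarrow> isCont M k"
proof -
  obtain p g where pg: "\<And>i j. mpoly_fun (p i j)" "\<And>i j. mpoly_fun (g i j)"
    "\<And>i j. g i j q \<noteq> 0" "\<And>i j k. M k $ i $ j = p i j k / g i j k"
    using assms unfolding rat_mat_regular_at_def rat_regular_at_def choice_iff by blast
  define G where "G k = (\<Prod>i\<in>UNIV. \<Prod>j\<in>UNIV. g i j k)" for k
  have "mpoly_fun G"
    unfolding G_def[abs_def] by (intro mpoly_fun_prod pg) auto
  moreover have "G q \<noteq> 0"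
    using pg(3) by (simp add: G_def prod_zero_iff)
  moreover have "isCont M k" if "G k \<noteq> 0" for k
  proof (rule isCont_matrixI)
    fix i j
    have "g i j k \<noteq> 0"
      using that by (simp add: G_def prod_zero_iff)
    then show "isCont (\<lambda>x. M x $ i $ j) k"
      unfolding pg(4) by (intro isCont_divide isCont_mpoly_fun pg)
  qed
  ultimately show thesis
    using that by blast
qed

section \<open>Derivatives along a line\<close>

lemma eventually_nhds_on_line:
  fixes a v :: "'a::real_normed_field^'n"
  assumes "\<forall>\<^sub>F k in nhds a. P k"
  shows "\<forall>\<^sub>F t in nhds 0. P (a + t *s v)"
proof -
  have "filterlim (\<lambda>t. a + t *s v) (nhds a) (nhds 0)"
    using isCont_line[where a=a and v=v and x=0] tendsto_at_iff_tendsto_nhds[of "\<lambda>t. a + t *s v" 0]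
    by (simp add: isCont_def)
  with assms show ?thesis
    by (rule eventually_compose_filterlim)
qed

lemma has_field_derivative_dirderiv:
  assumes "rat_regular_at q f"
  shows "((\<lambda>t. f (q + t *s \<xi>)) has_field_derivative dirderiv f q \<xi>) (at 0)"
proof -
  obtain p g where pg: "mpoly_fun p" "mpoly_fun g" "g q \<noteq> 0" "\<And>k. f k = p k / g k"
    using assms unfolding rat_regular_at_def by blast
  obtain P where P: "\<And>t. p (q + t *s \<xi>) = poly P t"
    using mpoly_fun_on_line[OF pg(1)] by blast
  obtain G where G: "\<And>t. g (q + t *s \<xi>) = poly G t"
    using mpoly_fun_on_line[OF pg(2)] by blast
  have "poly G 0 \<noteq> 0"
    using G[of 0] pg(3) by simp
  then have "(\<lambda>t. poly P t / poly G t) field_differentiable at 0"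
    using DERIV_divide[OF poly_DERIV poly_DERIV] unfolding field_differentiable_def by blast
  moreover have "(\<lambda>t. f (q + t *s \<xi>)) = (\<lambda>t. poly P t / poly G t)"
    using pg(4) P G by simp
  ultimately show ?thesis
    unfolding dirderiv_def by (simp add: DERIV_deriv_iff_field_differentiable)
qed

\<comment> \<open>\<open>dmat_dot\<close> for non-square matrices such as \<open>R\<close> and \<open>L\<close>\<close>
definition mat_dirderiv ::
  "(complex^'m \<Rightarrow> complex^'a^'b) \<Rightarrow> complex^'m \<Rightarrow> complex^'m \<Rightarrow> complex^'a^'b" where
  "mat_dirderiv M q \<xi> = (\<chi> i j. dirderiv (\<lambda>k. M k $ i $ j) q \<xi>)"

lemma dmat_dot_eq_mat_dirderiv: "dmat_dot d q \<xi> = mat_dirderiv d q \<xi>"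
  by (simp add: dmat_dot_def mat_dirderiv_def)

lemma has_field_derivative_matrix_mult_entry:
  assumes "rat_mat_regular_at q M" "rat_mat_regular_at q N"
  shows "((\<lambda>t. (M (q + t *s \<xi>) ** N (q + t *s \<xi>)) $ i $ j) has_field_derivative
    (mat_dirderiv M q \<xi> ** N q + M q ** mat_dirderiv N q \<xi>) $ i $ j) (at 0)"
proof -
  have "((\<lambda>t. \<Sum>l\<in>UNIV. M (q + t *s \<xi>) $ i $ l * N (q + t *s \<xi>) $ l $ j) has_field_derivative
      (\<Sum>l\<in>UNIV. mat_dirderiv M q \<xi> $ i $ l * N (q + 0 *s \<xi>) $ l $ j +
        mat_dirderiv N q \<xi> $ l $ j * M (q + 0 *s \<xi>) $ i $ l)) (at 0)"
    using assms unfolding rat_mat_regular_at_def mat_dirderiv_def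
    by (intro DERIV_sum DERIV_mult) (auto intro: has_field_derivative_dirderiv)
  then show ?thesis
    by (simp add: matrix_matrix_mult_def sum.distrib mult.commute)
qed

lemma mat_dirderiv_mult_eq:
  assumes "rat_mat_regular_at q M" "rat_mat_regular_at q N"
    and "rat_mat_regular_at q M'" "rat_mat_regular_at q N'"
    and eq: "\<forall>\<^sub>F t in nhds 0. M (q + t *s \<xi>) ** N (q + t *s \<xi>) = M' (q + t *s \<xi>) ** N' (q + t *s \<xi>)"
  shows "mat_dirderiv M q \<xi> ** N q + M q ** mat_dirderiv N q \<xi> =
    mat_dirderiv M' q \<xi> ** N' q + M' q ** mat_dirderiv N' q \<xi>"
proof -
  have "(mat_dirderiv M q \<xi> ** N q + M q ** mat_dirderiv N q \<xi>) $ i $ j =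
    (mat_dirderiv M' q \<xi> ** N' q + M' q ** mat_dirderiv N' q \<xi>) $ i $ j" for i j
  proof (rule DERIV_unique)
    have entry_eq: "\<forall>\<^sub>F t in nhds 0. (M (q + t *s \<xi>) ** N (q + t *s \<xi>)) $ i $ j =
      (M' (q + t *s \<xi>) ** N' (q + t *s \<xi>)) $ i $ j"
      using eq by (auto elim: eventually_mono)
    show "((\<lambda>t. (M' (q + t *s \<xi>) ** N' (q + t *s \<xi>)) $ i $ j) has_field_derivative
      (mat_dirderiv M q \<xi> ** N q + M q ** mat_dirderiv N q \<xi>) $ i $ j) (at 0)"
      using has_field_derivative_matrix_mult_entry[OF assms(1,2)]
      by (rule DERIV_cong_ev[OF refl entry_eq refl, THEN iffD1])
    show "((\<lambda>t. (M' (q + t *s \<xi>) ** N' (q + t *s \<xi>)) $ i $ j) has_field_derivative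
      (mat_dirderiv M' q \<xi> ** N' q + M' q ** mat_dirderiv N' q \<xi>) $ i $ j) (at 0)"
      using has_field_derivative_matrix_mult_entry[OF assms(3,4)] .
  qed
  then show ?thesis
    by (simp add: vec_eq_iff)
qed

section \<open>Homotopy equivalences over C(k)\<close>

lemma homotopy_equiv_Ck_sym:
  "homotopy_equiv_Ck degC degC' d d' R L u u' \<Longrightarrow> homotopy_equiv_Ck degC' degC d' d L R u' u"
  unfolding homotopy_equiv_Ck_def by blast

lemma homotopy_equiv_Ck_at_continuity_point:
  assumes equiv: "homotopy_equiv_Ck degC degC' d d' R L u u'"
    and cont: "isCont d k" "isCont d' k" "isCont R k" "isCont L k" "isCont u k" "isCont u' k"
  shows "mat_homotopy_equiv (d k) (d' k) (R k) (L k) (u k) (u' k)"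
proof -
  have RA: "eq_over_Ck (\<lambda>k. R k ** d k) (\<lambda>k. d' k ** R k)"
    and LA: "eq_over_Ck (\<lambda>k. L k ** d' k) (\<lambda>k. d k ** L k)"
    and LR: "eq_over_Ck (\<lambda>k. L k ** R k) (\<lambda>k. mat 1 - d k ** u k - u k ** d k)"
    and RL: "eq_over_Ck (\<lambda>k. R k ** L k) (\<lambda>k. mat 1 - d' k ** u' k - u' k ** d' k)"
    using equiv unfolding homotopy_equiv_Ck_def by blast+
  have "R k ** d k = d' k ** R k"
    using eq_over_Ck_imp_eq[OF RA] cont by (simp add: isCont_matrix_mult)
  moreover have "L k ** d' k = d k ** L k"
    using eq_over_Ck_imp_eq[OF LA] cont by (simp add: isCont_matrix_mult)
  moreover have "L k ** R k = mat 1 - d k ** u k - u k ** d k"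
    using eq_over_Ck_imp_eq[OF LR] cont by (simp add: isCont_matrix_mult isCont_diff)
  moreover have "R k ** L k = mat 1 - d' k ** u' k - u' k ** d' k"
    using eq_over_Ck_imp_eq[OF RL] cont by (simp add: isCont_matrix_mult isCont_diff)
  ultimately show ?thesis
    unfolding mat_homotopy_equiv_def by blast
qed

lemma homotopy_equiv_Ck_pointwise:
  assumes d: "poly_mat d" and d': "poly_mat d'"
    and equiv: "homotopy_equiv_Ck degC degC' d d' R L u u'"
    and "rat_mat_regular_at q R" "rat_mat_regular_at q L"
    and "rat_mat_regular_at q u" "rat_mat_regular_at q u'"
  obtains D where "mpoly_fun D" "D q \<noteq> 0"
    "\<And>k. D k \<noteq> 0 \<Longrightarrow> mat_homotopy_equiv (d k) (d' k) (R k) (L k) (u k) (u' k)"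
proof -
  obtain GR where GR: "mpoly_fun GR" "GR q \<noteq> 0" "\<And>k. GR k \<noteq> 0 \<Longrightarrow> isCont R k"
    using rat_mat_regular_at_continuous[OF assms(4)] by blast
  obtain GL where GL: "mpoly_fun GL" "GL q \<noteq> 0" "\<And>k. GL k \<noteq> 0 \<Longrightarrow> isCont L k"
    using rat_mat_regular_at_continuous[OF assms(5)] by blast
  obtain Gu where Gu: "mpoly_fun Gu" "Gu q \<noteq> 0" "\<And>k. Gu k \<noteq> 0 \<Longrightarrow> isCont u k"
    using rat_mat_regular_at_continuous[OF assms(6)] by blast
  obtain Gu' where Gu': "mpoly_fun Gu'" "Gu' q \<noteq> 0" "\<And>k. Gu' k \<noteq> 0 \<Longrightarrow> isCont u' k"
    using rat_mat_regular_at_continuous[OF assms(7)] by blast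
  define D where "D k = GR k * GL k * Gu k * Gu' k" for k
  have "mpoly_fun D"
    unfolding D_def[abs_def] using GR GL Gu Gu' by (intro mpoly_fun.mult)
  moreover have "D q \<noteq> 0"
    using GR GL Gu Gu' by (simp add: D_def)
  moreover have "mat_homotopy_equiv (d k) (d' k) (R k) (L k) (u k) (u' k)" if "D k \<noteq> 0" for k
    using that GR GL Gu Gu' isCont_poly_mat[OF d] isCont_poly_mat[OF d']
    by (intro homotopy_equiv_Ck_at_continuity_point[OF equiv]) (auto simp: D_def)
  ultimately show thesis
    using that by blast
qed

lemma induced_exact_dirderiv_transfer:
  assumes d: "poly_mat d" "\<And>k. d k ** d k = 0" and d': "poly_mat d'" "\<And>k. d' k ** d' k = 0"
    and R: "rat_mat_regular_at q R" and L: "rat_mat_regular_at q L"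
    and equiv: "\<forall>\<^sub>F k in nhds q. mat_homotopy_equiv (d k) (d' k) (R k) (L k) (u k) (u' k)"
    and exact: "induced_exact (d q) (dmat_dot d q \<xi>)"
  shows "induced_exact (d' q) (dmat_dot d' q \<xi>)"
proof -
  have equiv_line: "\<forall>\<^sub>F t in nhds 0. mat_homotopy_equiv (d (q + t *s \<xi>)) (d' (q + t *s \<xi>))
      (R (q + t *s \<xi>)) (L (q + t *s \<xi>)) (u (q + t *s \<xi>)) (u' (q + t *s \<xi>))"
    using eventually_nhds_on_line[OF equiv] .
  have regular: "rat_mat_regular_at q d" "rat_mat_regular_at q d'" "rat_mat_regular_at q (\<lambda>k. 0)"
    using d(1) d'(1) by (simp_all add: rat_mat_regular_at_poly_mat poly_mat_def mpoly_fun.const)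
  \<comment> \<open>Leibniz rule applied to \<open>d d = 0 0\<close>\<close>
  have "mat_dirderiv d q \<xi> ** d q + d q ** mat_dirderiv d q \<xi> = 0"
    using mat_dirderiv_mult_eq[OF regular(1,1,3,3), of \<xi>] d(2) by simp
  then have d_anticomm: "d q ** mat_dirderiv d q \<xi> + mat_dirderiv d q \<xi> ** d q = 0"
    by (simp add: add.commute)
  have "mat_dirderiv d' q \<xi> ** d' q + d' q ** mat_dirderiv d' q \<xi> = 0"
    using mat_dirderiv_mult_eq[OF regular(2,2,3,3), of \<xi>] d'(2) by simp
  then have d'_anticomm: "d' q ** mat_dirderiv d' q \<xi> + mat_dirderiv d' q \<xi> ** d' q = 0"
    by (simp add: add.commute)
  have "\<forall>\<^sub>F t in nhds 0. R (q + t *s \<xi>) ** d (q + t *s \<xi>) = d' (q + t *s \<xi>) ** R (q + t *s \<xi>)"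
    using equiv_line unfolding mat_homotopy_equiv_def by (auto elim: eventually_mono)
  then have R_dot: "mat_dirderiv R q \<xi> ** d q + R q ** mat_dirderiv d q \<xi> =
      mat_dirderiv d' q \<xi> ** R q + d' q ** mat_dirderiv R q \<xi>"
    by (rule mat_dirderiv_mult_eq[OF R regular(1) regular(2) R])
  have "\<forall>\<^sub>F t in nhds 0. L (q + t *s \<xi>) ** d' (q + t *s \<xi>) = d (q + t *s \<xi>) ** L (q + t *s \<xi>)"
    using equiv_line unfolding mat_homotopy_equiv_def by (auto elim: eventually_mono)
  then have L_dot: "mat_dirderiv L q \<xi> ** d' q + L q ** mat_dirderiv d' q \<xi> =
      mat_dirderiv d q \<xi> ** L q + d q ** mat_dirderiv L q \<xi>"
    by (rule mat_dirderiv_mult_eq[OF L regular(2) regular(1) L])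
  have "mat_homotopy_equiv (d q) (d' q) (R q) (L q) (u q) (u' q)"
    using equiv by (rule eventually_nhds_x_imp_x)
  from induced_exact_transfer[OF d(2) d'(2) d_anticomm d'_anticomm this R_dot L_dot] exact
  show ?thesis
    unfolding dmat_dot_eq_mat_dirderiv .
qed

lemma regular_homology_point_transfer:
  assumes d: "poly_complex degC d" and d': "poly_complex degC' d'"
    and equiv: "homotopy_equiv_Ck degC degC' d d' R L u u'"
    and R: "rat_mat_regular_at q R" and L: "rat_mat_regular_at q L"
    and u: "rat_mat_regular_at q u" and u': "rat_mat_regular_at q u'"
    and regular: "regular_homology_point Q d q"
  shows "regular_homology_point Q d' q"
proof -
  have d_complex: "poly_mat d" "\<And>k. d k ** d k = 0" and d'_complex: "poly_mat d'" "\<And>k. d' k ** d' k = 0"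
    using d d' unfolding poly_complex_def by blast+
  obtain D where D: "mpoly_fun D" "D q \<noteq> 0"
    and D_equiv: "\<And>k. D k \<noteq> 0 \<Longrightarrow> mat_homotopy_equiv (d k) (d' k) (R k) (L k) (u k) (u' k)"
    using homotopy_equiv_Ck_pointwise[OF d_complex(1) d'_complex(1) equiv R L u u'] by blast
  obtain g where g: "mpoly_fun g" "g q \<noteq> 0"
    and hdim_const: "\<And>k. Q k = 0 \<Longrightarrow> g k \<noteq> 0 \<Longrightarrow> hdim (d k) = hdim (d q)"
    using regular unfolding regular_homology_point_def by blast
  obtain \<xi> where \<xi>: "dirderiv Q q \<xi> \<noteq> 0" and exact: "induced_exact (d q) (dmat_dot d q \<xi>)"
    using regular unfolding regular_homology_point_def by blast
  have hdim_eq: "hdim (d k) = hdim (d' k)" if "D k \<noteq> 0" for k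
    using hdim_eq_if_mat_homotopy_equiv d_complex(2) d'_complex(2) D_equiv[OF that] by blast
  have "\<forall>\<^sub>F k in nhds q. mat_homotopy_equiv (d k) (d' k) (R k) (L k) (u k) (u' k)"
    using eventually_nhds_mpoly_fun_nonzero[OF D] D_equiv by (auto elim: eventually_mono)
  then have "induced_exact (d' q) (dmat_dot d' q \<xi>)"
    using exact by (rule induced_exact_dirderiv_transfer[OF d_complex d'_complex R L])
  moreover have "hdim (d' k) = hdim (d' q)" if "Q k = 0" "g k \<noteq> 0" "D k \<noteq> 0" for k
    using hdim_const[OF that(1,2)] hdim_eq[OF that(3)] hdim_eq[OF D(2)] by simp
  then have "\<exists>g. mpoly_fun g \<and> g q \<noteq> 0 \<and> (\<forall>k. Q k = 0 \<and> g k \<noteq> 0 \<longrightarrow> hdim (d' k) = hdim (d' q))"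
    using mpoly_fun.mult[OF g(1) D(1)] g(2) D(2) by (intro exI[of _ "\<lambda>k. g k * D k"]) auto
  ultimately show ?thesis
    using regular \<xi> unfolding regular_homology_point_def by blast
qed

theorem mainTheorem6:
  fixes Q :: "complex^'m \<Rightarrow> complex"
    and degC :: "'n::finite \<Rightarrow> int" and degC' :: "'p::finite \<Rightarrow> int"
    and d :: "complex^'m \<Rightarrow> complex^'n^'n" and d' :: "complex^'m \<Rightarrow> complex^'p^'p"
    and R :: "complex^'m \<Rightarrow> complex^'n^'p" and L :: "complex^'m \<Rightarrow> complex^'p^'n"
    and u :: "complex^'m \<Rightarrow> complex^'n^'n" and u' :: "complex^'m \<Rightarrow> complex^'p^'p"
    and q :: "complex^'m"
  assumes "irreducible_mpoly Q"
    and "poly_complex degC d" and "poly_complex degC' d'"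
    and "homology_only_along Q d" and "homology_only_along Q d'"
    and "Q q = 0"
    and "homotopy_equiv_Ck degC degC' d d' R L u u'"
    and "rat_mat_regular_at q R" and "rat_mat_regular_at q L"
    and "rat_mat_regular_at q u" and "rat_mat_regular_at q u'"
  shows "regular_homology_point Q d q \<longleftrightarrow> regular_homology_point Q d' q"
  using regular_homology_point_transfer[OF assms(2,3,7-11)]
    regular_homology_point_transfer[OF assms(3,2) homotopy_equiv_Ck_sym[OF assms(7)] assms(9,8,11,10)]
  by blast

end
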